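(* (i) Let $(A,M,\{P_x\}_{x\in X})$ be a matching relative Rota-Baxter algebra. Then the pair $(M,\{\prec_x,\succ_x\}_{x\in X})$ is a matching dendriform algebra, where the operations $\prec_x,\succ_x:M\otimes M\to M$ are given by $$u\prec_x v=u\cdot_M P_x(v)\quad\text{and}\quad u\succ_x v=P_x(u)\cdot_M v,\quad\text{for }u,v\in M,\ x\in X.$$ (ii) If $(A,M,\{P_x\}_{x\in X})$ and $(A',M',\{P'_x\}_{x\in X})$ are two matching relative Rota-Baxter algebras and $(\varphi,\psi)$ is a morphism between them, then the linear map $\psi:M\to M'$ is a morphism of the induced matching dendriform algebras from $(M,\{\prec_x,\succ_x\}_{x\in X})$ to $(M',\{\prec'_x,\succ'_x\}_{x\in X})$.
   Context: $\mathbb K$ is a commutative unital ring with $\mathrm{char}\,\mathbb K\neq 2$; all modules, linear maps and tensor products are over $\mathbb K$; $X$ is a nonempty set. A matching relative Rota-Baxter algebra is a triple $(A,M,\{P_x\}_{x\in X})$ of an associative algebra $A$ (product $\cdot$), an $A$-bimodule $M$ (actions $\cdot_M$) and linear maps $P_x:M\to A$ such that $P_x(u)\cdot P_y(v)=P_x(u\cdot_M P_y(v))+P_y(P_x(u)\cdot_M v)$ for all $u,v\in M$, $x,y\in X$. A morphism $(A,M,\{P_x\})\to(A',M',\{P'_x\})$ is a pair $(\varphi,\psi)$ of an algebra homomorphism $\varphi:A\to A'$ and a linear map $\psi:M\to M'$ with $\psi(a\cdot_Mu)=\varphi(a)\cdot_{M'}\psi(u)$, $\psi(u\cdot_Ma)=\psi(u)\cdot_{M'}\varphi(a)$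 and $\varphi\circ P_x=P'_x\circ\psi$ for all $a\in A,u\in M,x\in X$. A matching dendriform algebra is a $\mathbb K$-module $D$ with linear maps $\prec_x,\succ_x:D\otimes D\to D$ $(x\in X)$ such that for all $a,b,c\in D$, $x,y\in X$: $(a\prec_xb)\prec_yc=a\prec_x(b\prec_yc)+a\prec_y(b\succ_xc)$; $(a\succ_xb)\prec_yc=a\succ_x(b\prec_yc)$; $(a\prec_yb)\succ_xc+(a\succ_xb)\succ_yc=a\succ_x(b\succ_yc)$. A morphism of matching dendriform algebras is a linear map $f:D\to D'$ with $f(a\prec_xb)=f(a)\prec'_xf(b)$ and $f(a\succ_xb)=f(a)\succ'_xf(b)$ for all $a,b\in D$, $x\in X$. *)

theory Defs
  imports "HOL-Algebra.Module"
begin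

text \<open>The carrier-based counterpart of \<open>CHAR\<close>, which is only available for type classes.\<close>

definition ring_characteristic :: "('k, 'r) ring_scheme \<Rightarrow> nat" where
  "ring_characteristic R = Gcd {n :: nat. [n] \<cdot>\<^bsub>R\<^esub> \<one>\<^bsub>R\<^esub> = \<zero>\<^bsub>R\<^esub>}"

definition linear_map ::
    "('k, 'r) ring_scheme \<Rightarrow> ('k, 'm, 's) module_scheme \<Rightarrow> ('k, 'n, 't) module_scheme
      \<Rightarrow> ('m \<Rightarrow> 'n) \<Rightarrow> bool" where
  "linear_map R M N f \<longleftrightarrow>
    f \<in> carrier M \<rightarrow> carrier N \<and>
    (\<forall>u\<in>carrier M. \<forall>v\<in>carrier M. f (u \<oplus>\<^bsub>M\<^esub> v) = f u \<oplus>\<^bsub>N\<^esub> f v) \<and>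
    (\<forall>k\<in>carrier R. \<forall>u\<in>carrier M. f (k \<odot>\<^bsub>M\<^esub> u) = k \<odot>\<^bsub>N\<^esub> f u)"

text \<open>Linear maps out of a tensor product \<open>M \<otimes> N\<close> are represented by bilinear maps on
  \<open>M \<times> N\<close>.\<close>

definition bilinear_map ::
    "('k, 'r) ring_scheme \<Rightarrow> ('k, 'm, 's) module_scheme \<Rightarrow> ('k, 'n, 't) module_scheme
      \<Rightarrow> ('k, 'l, 'u) module_scheme \<Rightarrow> ('m \<Rightarrow> 'n \<Rightarrow> 'l) \<Rightarrow> bool" where
  "bilinear_map R M N L f \<longleftrightarrow>
    (\<forall>u\<in>carrier M. linear_map R N L (f u)) \<and>
    (\<forall>v\<in>carrier N. linear_map R M L (\<lambda>u. f u v))"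

text \<open>Associative algebras need be neither commutative nor unital, unlike those of the locale
  \<^locale>\<open>algebra\<close>.  The field \<open>one\<close> of the record \<open>A\<close> is unused here, and for a mere
  module \<open>M\<close> both \<open>one\<close> and \<open>mult\<close> are.\<close>

locale assoc_algebra = module R A for R (structure) and A (structure) +
  assumes mult_bilinear: "bilinear_map R A A A (\<lambda>a b. a \<otimes>\<^bsub>A\<^esub> b)"
    and mult_assoc: "\<lbrakk>a \<in> carrier A; b \<in> carrier A; c \<in> carrier A\<rbrakk>
      \<Longrightarrow> (a \<otimes>\<^bsub>A\<^esub> b) \<otimes>\<^bsub>A\<^esub> c = a \<otimes>\<^bsub>A\<^esub> (b \<otimes>\<^bsub>A\<^esub> c)"

locale bimodule = A: assoc_algebra R A + M: module R M
  for R (structure) and A (structure) and M (structure) +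
  fixes lact :: "'a \<Rightarrow> 'm \<Rightarrow> 'm" (infixr \<open>\<rightharpoonup>\<close> 72)
    and ract :: "'m \<Rightarrow> 'a \<Rightarrow> 'm" (infixl \<open>\<leftharpoonup>\<close> 72)
  assumes lact_bilinear: "bilinear_map R A M M lact"
    and ract_bilinear: "bilinear_map R M A M ract"
    and lact_mult: "\<lbrakk>a \<in> carrier A; b \<in> carrier A; u \<in> carrier M\<rbrakk>
      \<Longrightarrow> (a \<otimes>\<^bsub>A\<^esub> b) \<rightharpoonup> u = a \<rightharpoonup> (b \<rightharpoonup> u)"
    and lact_ract: "\<lbrakk>a \<in> carrier A; u \<in> carrier M; b \<in> carrier A\<rbrakk>
      \<Longrightarrow> (a \<rightharpoonup> u) \<leftharpoonup> b = a \<rightharpoonup> (u \<leftharpoonup> b)"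
    and ract_mult: "\<lbrakk>u \<in> carrier M; a \<in> carrier A; b \<in> carrier A\<rbrakk>
      \<Longrightarrow> (u \<leftharpoonup> a) \<leftharpoonup> b = u \<leftharpoonup> (a \<otimes>\<^bsub>A\<^esub> b)"

locale matching_rel_RB_algebra = bimodule R A M lact ract
  for R (structure) and X :: "'x set" and A (structure) and M (structure)
    and lact (infixr \<open>\<rightharpoonup>\<close> 72) and ract (infixl \<open>\<leftharpoonup>\<close> 72) +
  fixes P :: "'x \<Rightarrow> 'm \<Rightarrow> 'a"
  assumes P_linear: "x \<in> X \<Longrightarrow> linear_map R M A (P x)"
    and Rota_Baxter: "\<lbrakk>x \<in> X; y \<in> X; u \<in> carrier M; v \<in> carrier M\<rbrakk>
      \<Longrightarrow> P x u \<otimes>\<^bsub>A\<^esub> P y v = P x (u \<leftharpoonup> P y v) \<oplus>\<^bsub>A\<^esub> P y (P x u \<rightharpoonup> v)"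

locale matching_rel_RB_morphism =
    source: matching_rel_RB_algebra R X A M lact ract P +
    target: matching_rel_RB_algebra R X A' M' lact' ract' P'
  for R (structure) and X :: "'x set"
    and A (structure) and M (structure)
    and lact (infixr \<open>\<rightharpoonup>\<close> 72) and ract (infixl \<open>\<leftharpoonup>\<close> 72) and P
    and A' (structure) and M' (structure)
    and lact' (infixr \<open>\<rightharpoonup>''\<close> 72) and ract' (infixl \<open>\<leftharpoonup>''\<close> 72) and P' +
  fixes \<phi> :: "'a \<Rightarrow> 'b" and \<psi> :: "'m \<Rightarrow> 'n"
  assumes \<phi>_linear: "linear_map R A A' \<phi>"
    and \<phi>_mult: "\<lbrakk>a \<in> carrier A; b \<in> carrier A\<rbrakk>
      \<Longrightarrow> \<phi> (a \<otimes>\<^bsub>A\<^esub> b) = \<phi> a \<otimes>\<^bsub>A'\<^esub> \<phi> b"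
    and \<psi>_linear: "linear_map R M M' \<psi>"
    and \<psi>_lact: "\<lbrakk>a \<in> carrier A; u \<in> carrier M\<rbrakk> \<Longrightarrow> \<psi> (a \<rightharpoonup> u) = \<phi> a \<rightharpoonup>' \<psi> u"
    and \<psi>_ract: "\<lbrakk>u \<in> carrier M; a \<in> carrier A\<rbrakk> \<Longrightarrow> \<psi> (u \<leftharpoonup> a) = \<psi> u \<leftharpoonup>' \<phi> a"
    and \<phi>_P: "\<lbrakk>x \<in> X; u \<in> carrier M\<rbrakk> \<Longrightarrow> \<phi> (P x u) = P' x (\<psi> u)"

locale matching_dendriform_algebra = module R D
  for R (structure) and X :: "'x set" and D (structure) +
  fixes prec succ :: "'x \<Rightarrow> 'd \<Rightarrow> 'd \<Rightarrow> 'd"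
  assumes prec_bilinear: "x \<in> X \<Longrightarrow> bilinear_map R D D D (prec x)"
    and succ_bilinear: "x \<in> X \<Longrightarrow> bilinear_map R D D D (succ x)"
    and prec_prec:
      "\<lbrakk>x \<in> X; y \<in> X; a \<in> carrier D; b \<in> carrier D; c \<in> carrier D\<rbrakk>
        \<Longrightarrow> prec y (prec x a b) c = prec x a (prec y b c) \<oplus>\<^bsub>D\<^esub> prec y a (succ x b c)"
    and succ_prec:
      "\<lbrakk>x \<in> X; y \<in> X; a \<in> carrier D; b \<in> carrier D; c \<in> carrier D\<rbrakk>
        \<Longrightarrow> prec y (succ x a b) c = succ x a (prec y b c)"
    and succ_succ:
      "\<lbrakk>x \<in> X; y \<in> X; a \<in> carrier D; b \<in> carrier D; c \<in> carrier D\<rbrakk>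
        \<Longrightarrow> succ x (prec y a b) c \<oplus>\<^bsub>D\<^esub> succ y (succ x a b) c = succ x a (succ y b c)"

locale matching_dendriform_morphism =
    source: matching_dendriform_algebra R X D prec succ +
    target: matching_dendriform_algebra R X D' prec' succ'
  for R (structure) and X :: "'x set"
    and D (structure) and prec succ
    and D' (structure) and prec' succ' +
  fixes f :: "'d \<Rightarrow> 'e"
  assumes f_linear: "linear_map R D D' f"
    and f_prec: "\<lbrakk>x \<in> X; a \<in> carrier D; b \<in> carrier D\<rbrakk>
      \<Longrightarrow> f (prec x a b) = prec' x (f a) (f b)"
    and f_succ: "\<lbrakk>x \<in> X; a \<in> carrier D; b \<in> carrier D\<rbrakk>
      \<Longrightarrow> f (succ x a b) = succ' x (f a) (f b)"

end

theory Submission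
  imports Defs
begin

text \<open>The idea is that \<open>M\<close> acts on itself through the maps \<open>P\<^sub>x\<close>: in both operations one
  factor is first sent to \<open>A\<close>.  Each dendriform axiom then says how an iterated action behaves.
  The mixed axiom is the compatibility of the left and the right action.  In the other two, the
  bimodule law turns an iterated action on the same side into one action of a product
  \<open>P\<^sub>x u \<cdot> P\<^sub>y v\<close>; the Rota--Baxter identity expands this product into the two terms
  \<open>P\<^sub>x (u \<prec>\<^sub>y v)\<close> and \<open>P\<^sub>y (u \<succ>\<^sub>x v)\<close>, and additivity of the action
  separates them.  Morphisms preserve both the actions and the maps \<open>P\<^sub>x\<close>, and the operations
  are composed of nothing else.\<close>

lemma linear_map_closed:
  assumes "linear_map R M N f" and "u \<in> carrier M"
  shows "f u \<in> carrier N"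
  using assms unfolding linear_map_def by blast

lemma linear_map_compose:
  assumes "linear_map R M N f" and "linear_map R N L g"
  shows "linear_map R M L (\<lambda>u. g (f u))"
  using assms unfolding linear_map_def by (simp add: Pi_iff)

lemma bilinear_map_compose_left:
  assumes "bilinear_map R N K L b" and "linear_map R M N f"
  shows "bilinear_map R M K L (\<lambda>u v. b (f u) v)"
  using assms unfolding bilinear_map_def
  by (auto intro: linear_map_compose[where g = "\<lambda>u. b u _"] linear_map_closed)

lemma bilinear_map_compose_right:
  assumes "bilinear_map R K N L b" and "linear_map R M N f"
  shows "bilinear_map R K M L (\<lambda>u v. b u (f v))"
  using assms unfolding bilinear_map_def
  by (auto intro: linear_map_compose linear_map_closed)

lemma bilinear_map_closed:
  assumes "bilinear_map R M N L b" and "u \<in> carrier M" and "v \<in> carrier N"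
  shows "b u v \<in> carrier L"
  using assms unfolding bilinear_map_def linear_map_def by blast

lemma bilinear_map_add_left:
  assumes "bilinear_map R M N L b"
    and "u \<in> carrier M" and "u' \<in> carrier M" and "v \<in> carrier N"
  shows "b (u \<oplus>\<^bsub>M\<^esub> u') v = b u v \<oplus>\<^bsub>L\<^esub> b u' v"
  using assms unfolding bilinear_map_def linear_map_def by blast

lemma bilinear_map_add_right:
  assumes "bilinear_map R M N L b"
    and "u \<in> carrier M" and "v \<in> carrier N" and "v' \<in> carrier N"
  shows "b u (v \<oplus>\<^bsub>N\<^esub> v') = b u v \<oplus>\<^bsub>L\<^esub> b u v'"
  using assms unfolding bilinear_map_def linear_map_def by blast

context matching_rel_RB_algebra
begin

lemma P_closed: "\<lbrakk>x \<in> X; u \<in> carrier M\<rbrakk> \<Longrightarrow> P x u \<in> carrier A"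
  using P_linear by (rule linear_map_closed)

lemmas lact_closed = bilinear_map_closed[OF lact_bilinear]
  and ract_closed = bilinear_map_closed[OF ract_bilinear]

text \<open>The two consequences of the Rota--Baxter identity that make the induced operations
  dendriform: it is applied to the product that acts, on the right and on the left
  respectively.\<close>

lemma ract_P_ract_P:
  assumes "x \<in> X" "y \<in> X" "u \<in> carrier M" "v \<in> carrier M" "w \<in> carrier M"
  shows "(u \<leftharpoonup> P x v) \<leftharpoonup> P y w = (u \<leftharpoonup> P x (v \<leftharpoonup> P y w)) \<oplus>\<^bsub>M\<^esub> (u \<leftharpoonup> P y (P x v \<rightharpoonup> w))"
proof -
  have "(u \<leftharpoonup> P x v) \<leftharpoonup> P y w = u \<leftharpoonup> (P x v \<otimes>\<^bsub>A\<^esub> P y w)"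
    using assms by (simp add: ract_mult P_closed)
  also have "\<dots> = u \<leftharpoonup> (P x (v \<leftharpoonup> P y w) \<oplus>\<^bsub>A\<^esub> P y (P x v \<rightharpoonup> w))"
    using assms by (simp add: Rota_Baxter)
  also have "\<dots> = (u \<leftharpoonup> P x (v \<leftharpoonup> P y w)) \<oplus>\<^bsub>M\<^esub> (u \<leftharpoonup> P y (P x v \<rightharpoonup> w))"
    using assms
    by (simp add: bilinear_map_add_right[OF ract_bilinear] P_closed lact_closed ract_closed)
  finally show ?thesis .
qed

lemma lact_P_lact_P:
  assumes "x \<in> X" "y \<in> X" "u \<in> carrier M" "v \<in> carrier M" "w \<in> carrier M"
  shows "P x u \<rightharpoonup> (P y v \<rightharpoonup> w) = (P x (u \<leftharpoonup> P y v) \<rightharpoonup> w) \<oplus>\<^bsub>M\<^esub> (P y (P x u \<rightharpoonup> v) \<rightharpoonup> w)"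
proof -
  have "P x u \<rightharpoonup> (P y v \<rightharpoonup> w) = (P x u \<otimes>\<^bsub>A\<^esub> P y v) \<rightharpoonup> w"
    using assms by (simp add: lact_mult P_closed)
  also have "\<dots> = (P x (u \<leftharpoonup> P y v) \<oplus>\<^bsub>A\<^esub> P y (P x u \<rightharpoonup> v)) \<rightharpoonup> w"
    using assms by (simp add: Rota_Baxter)
  also have "\<dots> = (P x (u \<leftharpoonup> P y v) \<rightharpoonup> w) \<oplus>\<^bsub>M\<^esub> (P y (P x u \<rightharpoonup> v) \<rightharpoonup> w)"
    using assms
    by (simp add: bilinear_map_add_left[OF lact_bilinear] P_closed lact_closed ract_closed)
  finally show ?thesis .
qed

lemma induced_matching_dendriform_algebra:
  "matching_dendriform_algebra R X M (\<lambda>x u v. u \<leftharpoonup> P x v) (\<lambda>x u v. P x u \<rightharpoonup> v)"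
proof unfold_locales
  fix x assume "x \<in> X"
  then show "bilinear_map R M M M (\<lambda>u v. u \<leftharpoonup> P x v)"
    by (intro bilinear_map_compose_right[OF ract_bilinear] P_linear)
next
  fix x assume "x \<in> X"
  then show "bilinear_map R M M M (\<lambda>u v. P x u \<rightharpoonup> v)"
    by (intro bilinear_map_compose_left[OF lact_bilinear] P_linear)
qed (simp_all add: ract_P_ract_P lact_P_lact_P lact_ract P_closed)

end

lemma (in matching_rel_RB_morphism) induced_matching_dendriform_morphism:
  "matching_dendriform_morphism R X
     M (\<lambda>x u v. u \<leftharpoonup> P x v) (\<lambda>x u v. P x u \<rightharpoonup> v)
     M' (\<lambda>x u v. u \<leftharpoonup>' P' x v) (\<lambda>x u v. P' x u \<rightharpoonup>' v) \<psi>"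
proof (intro matching_dendriform_morphism.intro matching_dendriform_morphism_axioms.intro
    source.induced_matching_dendriform_algebra target.induced_matching_dendriform_algebra)
  show "linear_map R M M' \<psi>"
    by (rule \<psi>_linear)
qed (simp_all add: \<psi>_lact \<psi>_ract \<phi>_P source.P_closed)

theorem proposition3p12:
  fixes R :: "('k, 'r) ring_scheme" and X :: "'x set"
    and A :: "('k, 'a, 's) module_scheme" and M :: "('k, 'm, 't) module_scheme"
    and lact :: "'a \<Rightarrow> 'm \<Rightarrow> 'm" and ract :: "'m \<Rightarrow> 'a \<Rightarrow> 'm"
    and P :: "'x \<Rightarrow> 'm \<Rightarrow> 'a"
    and A' :: "('k, 'b, 'u) module_scheme" and M' :: "('k, 'n, 'v) module_scheme"
    and lact' :: "'b \<Rightarrow> 'n \<Rightarrow> 'n" and ract' :: "'n \<Rightarrow> 'b \<Rightarrow> 'n"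
    and P' :: "'x \<Rightarrow> 'n \<Rightarrow> 'b"
    and \<phi> :: "'a \<Rightarrow> 'b" and \<psi> :: "'m \<Rightarrow> 'n"
  assumes "cring R" and "ring_characteristic R \<noteq> 2" and "X \<noteq> {}"
  shows "(matching_rel_RB_algebra R X A M lact ract P \<longrightarrow>
           matching_dendriform_algebra R X M
             (\<lambda>x u v. ract u (P x v)) (\<lambda>x u v. lact (P x u) v)) \<and>
         (matching_rel_RB_algebra R X A M lact ract P \<and>
          matching_rel_RB_algebra R X A' M' lact' ract' P' \<and>
          matching_rel_RB_morphism R X A M lact ract P A' M' lact' ract' P' \<phi> \<psi> \<longrightarrow>
           matching_dendriform_morphism R X
             M (\<lambda>x u v. ract u (P x v)) (\<lambda>x u v. lact (P x u) v)
             M' (\<lambda>x u v. ract' u (P' x v)) (\<lambda>x u v. lact' (P' x u) v) \<psi>)"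
  by (intro conjI impI; (elim conjE)?)
    (rule matching_rel_RB_algebra.induced_matching_dendriform_algebra
      matching_rel_RB_morphism.induced_matching_dendriform_morphism, assumption)+

end
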